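(* Let $G$ be a simple graph on $l$ vertices, with chromatic polynomial $\chi(G;q)$ and bond lattice $L_G$ with minimal element $\hat 0$, and let $L:=|L_G|$. Let $Z$ be the $L\times L$ matrix, with rows and columns indexed by the elements of $L_G$, given by $$Z_{\pi,\pi'}:=\begin{cases}-w(\pi,\pi') & \text{if }\pi\text{ covers }\pi'\text{ in }L_G,\\ q & \text{if }\pi=\pi'=\hat 0,\\ 0&\text{otherwise,}\end{cases}$$ and let $\zeta$ be the column vector of length $L$ all of whose entries are $1$. Then $$\chi(G;q)=\zeta^{T}\,Z^{l}\,\zeta.$$
   Context: $G$ is a simple graph on $l$ vertices, not assumed connected, with vertex set $\Pi$. The chromatic polynomial $\chi(G;q)$ is the polynomial in $q$ whose value at each positive integer $q$ is the number of proper vertex colorings of $G$ with $q$ colors. A non-empty $S\subset\Pi$ is called connected if the subgraph of $G$ induced by $S$ is connected. The bond lattice $L_G$ is the set of all partitions $\pi=\{S_1,\dots,S_k\}$ of $\Pi$ into non-empty pairwise disjoint connected subsets, partially ordered by refinement: $\pi\ge\pi'$ iff $\pi'$ refines $\pi$. $\hat 0$ is the partition into $l$ singletons. For $\pi=\{S_1,\dots,S_k\}\in L_G$, $d(\pi):=\#\{1\le i\le k:|S_i|>1\}$ is the number of non-singleton parts. For $S\subset\Pi$, $\boldsymbol{e}(S)$ is the number of edges of $G$ with both ends in $S$; for disjoint $S,S'$, $\boldsymbol{e}(S,S')$ is the number of edges of $G$ with one end in $S$ and the other in $S'$. If $\pi$ covers $\pi'$ in $L_G$, one can write $\pi=\{S_1,\dots,S_k\}$,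 $\pi'=\{S'_1,\dots,S'_{k+1}\}$ with $S_i=S'_i$ for $1\le i<k$ and $S_k=S'_k\sqcup S'_{k+1}$, and one defines $$w(\pi,\pi'):=\frac{1}{d(\pi)}\,\frac{\boldsymbol{e}(S'_k,S'_{k+1})}{\boldsymbol{e}(S_k)}.$$ *)

theory Defs
  imports "HOL-Computational_Algebra.Polynomial" Jordan_Normal_Form.Matrix
    "HOL-Library.Disjoint_Sets" "HOL-Library.FuncSet"
begin

definition simple_graph :: "'a set \<Rightarrow> 'a set set \<Rightarrow> bool" where
  "simple_graph V E \<longleftrightarrow> finite V \<and> (\<forall>e\<in>E. e \<subseteq> V \<and> card e = 2)"

definition proper_colorings :: "'a set \<Rightarrow> 'a set set \<Rightarrow> nat \<Rightarrow> ('a \<Rightarrow> nat) set" where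
  "proper_colorings V E q = {c \<in> V \<rightarrow>\<^sub>E {..<q}. \<forall>u v. {u, v} \<in> E \<longrightarrow> c u \<noteq> c v}"

definition chromatic_polynomial :: "'a set \<Rightarrow> 'a set set \<Rightarrow> rat poly" where
  "chromatic_polynomial V E =
     (THE p. \<forall>q>0. poly p (of_nat q) = of_nat (card (proper_colorings V E q)))"

lemma chromatic_polynomial_unique:
  fixes p p' :: "rat poly"
  assumes "\<forall>q>0. poly p (of_nat q) = of_nat (card (proper_colorings V E q))"
    and "\<forall>q>0. poly p' (of_nat q) = of_nat (card (proper_colorings V E q))"
  shows "p = p'"
proof (rule ccontr)
  assume "p \<noteq> p'"
  then have "finite {x. poly (p - p') x = 0}"
    by (intro poly_roots_finite) auto
  moreover have "of_nat ` {0<..} \<subseteq> {x. poly (p - p') x = 0}"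
    using assms by auto
  ultimately have "finite ((of_nat :: nat \<Rightarrow> rat) ` {0<..})"
    by (rule rev_finite_subset)
  then have "finite {0::nat<..}"
    by (rule finite_imageD) (auto simp: inj_on_def)
  then show False
    using infinite_Ioi by blast
qed

lemma card_colorings_image_eq:
  assumes "simple_graph V E" "finite T"
  shows "card {c \<in> V \<rightarrow>\<^sub>E T. c ` V = T \<and> (\<forall>u v. {u, v} \<in> E \<longrightarrow> c u \<noteq> c v)}
       = card {c \<in> V \<rightarrow>\<^sub>E {..<card T}. c ` V = {..<card T} \<and> (\<forall>u v. {u, v} \<in> E \<longrightarrow> c u \<noteq> c v)}"
    (is "card ?A = card ?B")
proof -
  obtain g where g: "bij_betw g T {..<card T}"
    using assms(2) bij_betw_iff_card by (metis card_lessThan finite_lessThan)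
  define h where "h = inv_into T g"
  have h: "bij_betw h {..<card T} T"
    unfolding h_def using g by (rule bij_betw_inv_into)
  have hg: "h (g x) = x" if "x \<in> T" for x
    unfolding h_def using g that by (rule bij_betw_inv_into_left)
  have gh: "g (h x) = x" if "x < card T" for x
    unfolding h_def using g that by (simp add: bij_betw_inv_into_right)
  have gT: "g x < card T" if "x \<in> T" for x
    using g that by (auto dest: bij_betwE)
  have hT: "h x \<in> T" if "x < card T" for x
    using h that by (auto dest: bij_betwE)
  have EV: "u \<in> V" "v \<in> V" if "{u, v} \<in> E" for u v
    using assms(1) that unfolding simple_graph_def by auto
  have "bij_betw (\<lambda>c. \<lambda>v\<in>V. g (c v)) ?A ?B"
  proof (rule bij_betw_byWitness[where f' = "\<lambda>c. \<lambda>v\<in>V. h (c v)"])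
    show "\<forall>c\<in>?A. (\<lambda>v\<in>V. h ((\<lambda>v\<in>V. g (c v)) v)) = c"
      by (auto simp: fun_eq_iff restrict_def hg PiE_def extensional_def Pi_def)
    show "\<forall>c\<in>?B. (\<lambda>v\<in>V. g ((\<lambda>v\<in>V. h (c v)) v)) = c"
      by (auto simp: fun_eq_iff restrict_def gh PiE_def extensional_def Pi_def)
    show "(\<lambda>c. \<lambda>v\<in>V. g (c v)) ` ?A \<subseteq> ?B"
    proof
      fix d assume "d \<in> (\<lambda>c. \<lambda>v\<in>V. g (c v)) ` ?A"
      then obtain c where c: "c \<in> V \<rightarrow>\<^sub>E T" "c ` V = T" "\<forall>u v. {u, v} \<in> E \<longrightarrow> c u \<noteq> c v"
        and d: "d = (\<lambda>v\<in>V. g (c v))"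
        by auto
      have "d ` V = g ` (c ` V)" unfolding d by (auto simp: image_image)
      then have "d ` V = {..<card T}" using c(2) g by (simp add: bij_betw_def)
      moreover have "d \<in> V \<rightarrow>\<^sub>E {..<card T}" using c(1) gT unfolding d by (auto simp: PiE_def Pi_def)
      moreover have "d u \<noteq> d v" if e: "{u, v} \<in> E" for u v
      proof
        assume "d u = d v"
        then have "h (g (c u)) = h (g (c v))" unfolding d using EV[OF e] by simp
        moreover have "c u \<in> T" "c v \<in> T" using c(1) EV[OF e] by auto
        ultimately show False using hg c(3) e by auto
      qed
      ultimately show "d \<in> ?B" by blast
    qed
    show "(\<lambda>c. \<lambda>v\<in>V. h (c v)) ` ?B \<subseteq> ?A"
    proof
      fix d assume "d \<in> (\<lambda>c. \<lambda>v\<in>V. h (c v)) ` ?B"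
      then obtain c where c: "c \<in> V \<rightarrow>\<^sub>E {..<card T}" "c ` V = {..<card T}"
          "\<forall>u v. {u, v} \<in> E \<longrightarrow> c u \<noteq> c v"
        and d: "d = (\<lambda>v\<in>V. h (c v))"
        by auto
      have "d ` V = h ` (c ` V)" unfolding d by (auto simp: image_image)
      then have "d ` V = T" using c(2) h by (simp add: bij_betw_def)
      moreover have "d \<in> V \<rightarrow>\<^sub>E T" using c(1) hT unfolding d by (auto simp: PiE_def Pi_def)
      moreover have "d u \<noteq> d v" if e: "{u, v} \<in> E" for u v
      proof
        assume "d u = d v"
        then have "g (h (c u)) = g (h (c v))" unfolding d using EV[OF e] by simp
        moreover have "c u < card T" "c v < card T" using c(1) EV[OF e] by auto
        ultimately show False using gh c(3) e by auto
      qed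
      ultimately show "d \<in> ?A" by blast
    qed
  qed
  then show ?thesis by (rule bij_betw_same_card)
qed

lemma chromatic_polynomial_exists:
  assumes "simple_graph V E"
  shows "\<exists>p :: rat poly. \<forall>q>0. poly p (of_nat q) = of_nat (card (proper_colorings V E q))"
proof -
  have fin: "finite V" using assms by (simp add: simple_graph_def)
  define A where "A T = {c \<in> V \<rightarrow>\<^sub>E T. c ` V = T \<and> (\<forall>u v. {u, v} \<in> E \<longrightarrow> c u \<noteq> c v)}" for T :: "nat set"
  define a where "a k = card (A {..<k})" for k :: nat
  define p :: "rat poly" where
    "p = (\<Sum>k\<le>card V. [:of_nat (a k) / fact k:] * (\<Prod>i<k. [:- of_nat i, 1:]))"
  have cardA: "card (A T) = a (card T)" if "finite T" for T
    unfolding A_def a_def using card_colorings_image_eq[OF assms that] .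
  have choose: "(of_nat (q choose k) :: rat) = (\<Prod>i<k. of_nat q - of_nat i) / fact k" for q k
    by (simp add: binomial_gbinomial gbinomial_prod_rev atLeast0LessThan)
  have "poly p (of_nat q) = of_nat (card (proper_colorings V E q))" for q
  proof -
    have U: "proper_colorings V E q = (\<Union>T\<in>Pow {..<q}. A T)"
      unfolding proper_colorings_def A_def by (auto simp: PiE_def Pi_def)
    have finA: "finite (A T)" if "finite T" for T
      unfolding A_def using fin that by (auto intro: finite_subset[OF _ finite_PiE[of V "\<lambda>_. T"]])
    have "card (proper_colorings V E q) = (\<Sum>T\<in>Pow {..<q}. card (A T))"
      unfolding U
    proof (rule card_UN_disjoint)
      show "\<forall>T\<in>Pow {..<q}. finite (A T)"
        using finA finite_subset[OF _ finite_lessThan] by auto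
      show "\<forall>T\<in>Pow {..<q}. \<forall>T'\<in>Pow {..<q}. T \<noteq> T' \<longrightarrow> A T \<inter> A T' = {}"
        by (auto simp: A_def)
    qed simp
    also have "\<dots> = (\<Sum>T\<in>Pow {..<q}. a (card T))"
      by (intro sum.cong refl cardA) (auto intro: finite_subset)
    also have "\<dots> = (\<Sum>k\<le>q. \<Sum>T\<in>{T\<in>Pow {..<q}. card T = k}. a (card T))"
      by (rule sum.group[symmetric]) (auto dest: card_mono[rotated])
    also have "\<dots> = (\<Sum>k\<le>q. (q choose k) * a k)"
    proof (rule sum.cong[OF refl])
      fix k
      have "card {T \<in> Pow {..<q}. card T = k} = q choose k"
        using n_subsets[of "{..<q}" k] by simp
      then show "(\<Sum>T\<in>{T\<in>Pow {..<q}. card T = k}. a (card T)) = (q choose k) * a k"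
        by simp
    qed
    also have "\<dots> = (\<Sum>k\<le>max q (card V). (q choose k) * a k)"
      by (rule sum.mono_neutral_left) auto
    also have "\<dots> = (\<Sum>k\<le>card V. (q choose k) * a k)"
    proof (rule sum.mono_neutral_right)
      show "\<forall>k\<in>{..max q (card V)} - {..card V}. (q choose k) * a k = 0"
      proof
        fix k assume "k \<in> {..max q (card V)} - {..card V}"
        then have k: "card V < k" by auto
        have "A {..<k} = {}"
        proof (rule ccontr)
          assume "A {..<k} \<noteq> {}"
          then obtain c where "c ` V = {..<k}" unfolding A_def by auto
          then have "k \<le> card V" using card_image_le[OF fin, of c] by simp
          then show False using k by simp
        qed
        then show "(q choose k) * a k = 0" by (simp add: a_def)
      qed
    qed auto
    finally have "of_nat (card (proper_colorings V E q))
        = (\<Sum>k\<le>card V. of_nat (q choose k) * of_nat (a k) :: rat)"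
      by simp
    then show ?thesis
      unfolding p_def choose by (simp add: poly_sum poly_prod mult.commute)
  qed
  then show ?thesis by blast
qed

lemma poly_chromatic_polynomial:
  assumes "simple_graph V E" "q > 0"
  shows "poly (chromatic_polynomial V E) (of_nat q) = of_nat (card (proper_colorings V E q))"
proof -
  have "\<exists>!p :: rat poly. \<forall>q>0. poly p (of_nat q) = of_nat (card (proper_colorings V E q))"
    using chromatic_polynomial_exists[OF assms(1)] chromatic_polynomial_unique by blast
  from theI'[OF this] show ?thesis
    using assms(2) unfolding chromatic_polynomial_def by blast
qed

definition connected_set :: "'a set set \<Rightarrow> 'a set \<Rightarrow> bool" where
  "connected_set E S \<longleftrightarrow>
     S \<noteq> {} \<and> (\<forall>u\<in>S. \<forall>v\<in>S. (u, v) \<in> {(x, y). x \<in> S \<and> y \<in> S \<and> {x, y} \<in> E}\<^sup>*)"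

definition bond_lattice :: "'a set \<Rightarrow> 'a set set \<Rightarrow> 'a set set set" where
  "bond_lattice V E = {\<pi>. partition_on V \<pi> \<and> (\<forall>S\<in>\<pi>. connected_set E S)}"

definition bond_bot :: "'a set \<Rightarrow> 'a set set" where
  "bond_bot V = (\<lambda>v. {v}) ` V"

definition bond_covers :: "'a set \<Rightarrow> 'a set set \<Rightarrow> 'a set set \<Rightarrow> 'a set set \<Rightarrow> bool" where
  "bond_covers V E \<pi> \<pi>' \<longleftrightarrow>
     \<pi> \<in> bond_lattice V E \<and> \<pi>' \<in> bond_lattice V E \<and> \<pi>' \<noteq> \<pi> \<and> refines V \<pi>' \<pi> \<and>
     (\<forall>\<rho>\<in>bond_lattice V E. refines V \<pi>' \<rho> \<and> refines V \<rho> \<pi> \<longrightarrow> \<rho> = \<pi>' \<or> \<rho> = \<pi>)"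

definition num_nonsingleton :: "'a set set \<Rightarrow> nat" where
  "num_nonsingleton \<pi> = card {S \<in> \<pi>. card S > 1}"

definition edges_within :: "'a set set \<Rightarrow> 'a set \<Rightarrow> nat" where
  "edges_within E S = card {e \<in> E. e \<subseteq> S}"

definition edges_between :: "'a set set \<Rightarrow> 'a set \<Rightarrow> 'a set \<Rightarrow> nat" where
  "edges_between E S S' = card {e \<in> E. \<exists>u\<in>S. \<exists>v\<in>S'. e = {u, v}}"

text \<open>
  When \<open>\<pi>\<close> covers \<open>\<pi>'\<close>, the two partitions differ exactly in that one part \<open>S\<close> of \<open>\<pi>\<close> is
  split into two parts \<open>A\<close>, \<open>B\<close> of \<open>\<pi>'\<close>. The pair is only determined up to order, but the
  value does not depend on the order.
\<close>
definition bond_weight :: "'a set set \<Rightarrow> 'a set set \<Rightarrow> 'a set set \<Rightarrow> rat" where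
  "bond_weight E \<pi> \<pi>' =
     (THE r. \<exists>S A B. \<pi> - \<pi>' = {S} \<and> \<pi>' - \<pi> = {A, B} \<and> A \<noteq> B \<and> A \<inter> B = {} \<and> S = A \<union> B \<and>
        r = 1 / of_nat (num_nonsingleton \<pi>)
              * (of_nat (edges_between E A B) / of_nat (edges_within E S)))"

lemma edges_between_commute: "edges_between E A B = edges_between E B A"
  unfolding edges_between_def by (rule arg_cong[where f = card]) (auto simp: insert_commute)

lemma bond_weight_eq:
  assumes "\<pi> - \<pi>' = {S}" "\<pi>' - \<pi> = {A, B}" "A \<noteq> B" "A \<inter> B = {}" "S = A \<union> B"
  shows "bond_weight E \<pi> \<pi>' = 1 / of_nat (num_nonsingleton \<pi>)
           * (of_nat (edges_between E A B) / of_nat (edges_within E S))"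
  unfolding bond_weight_def
proof (rule the_equality)
  show "\<exists>S' A' B'. \<pi> - \<pi>' = {S'} \<and> \<pi>' - \<pi> = {A', B'} \<and> A' \<noteq> B' \<and> A' \<inter> B' = {} \<and> S' = A' \<union> B' \<and>
     1 / of_nat (num_nonsingleton \<pi>) * (of_nat (edges_between E A B) / of_nat (edges_within E S))
     = 1 / of_nat (num_nonsingleton \<pi>)
         * (of_nat (edges_between E A' B') / (of_nat (edges_within E S') :: rat))"
    using assms by blast
next
  fix r :: rat
  assume "\<exists>S' A' B'. \<pi> - \<pi>' = {S'} \<and> \<pi>' - \<pi> = {A', B'} \<and> A' \<noteq> B' \<and> A' \<inter> B' = {} \<and> S' = A' \<union> B' \<and>
     r = 1 / of_nat (num_nonsingleton \<pi>)
         * (of_nat (edges_between E A' B') / of_nat (edges_within E S'))"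
  then obtain S' A' B' where *: "\<pi> - \<pi>' = {S'}" "\<pi>' - \<pi> = {A', B'}"
    and r: "r = 1 / of_nat (num_nonsingleton \<pi>)
         * (of_nat (edges_between E A' B') / of_nat (edges_within E S'))"
    by blast
  have "S' = S"
    using * assms by auto
  moreover have "A' = A \<and> B' = B \<or> A' = B \<and> B' = A"
    using * assms by (metis doubleton_eq_iff)
  ultimately show "r = 1 / of_nat (num_nonsingleton \<pi>)
      * (of_nat (edges_between E A B) / of_nat (edges_within E S))"
    unfolding r using edges_between_commute by metis
qed

text \<open>The indeterminate \<open>q\<close> is the polynomial \<open>[:0, 1:]\<close>.\<close>
definition bond_entry :: "'a set \<Rightarrow> 'a set set \<Rightarrow> 'a set set \<Rightarrow> 'a set set \<Rightarrow> rat poly" where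
  "bond_entry V E \<pi> \<pi>' =
     (if bond_covers V E \<pi> \<pi>' then [:- bond_weight E \<pi> \<pi>':]
      else if \<pi> = \<pi>' \<and> \<pi>' = bond_bot V then [:0, 1:]
      else 0)"

text \<open>
  The function \<open>b\<close> enumerates the bond lattice, so that its elements can index the rows
  and columns.
\<close>
definition bond_matrix ::
    "'a set \<Rightarrow> 'a set set \<Rightarrow> (nat \<Rightarrow> 'a set set) \<Rightarrow> rat poly mat" where
  "bond_matrix V E b =
     mat (card (bond_lattice V E)) (card (bond_lattice V E)) (\<lambda>(i, j). bond_entry V E (b i) (b j))"

end

theory Submission
  imports Defs
begin

text \<open>
  Write \<open>M(\<pi>)\<close> for the sum of \<open>(-1)\<^sup>|\<^sup>F\<^sup>|\<close> over the edge sets \<open>F\<close> whose connected components form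
  the partition \<open>\<pi>\<close>. Expanding the product of \<open>1 - [c u = c v]\<close> over the edges \<open>{u, v}\<close> gives Whitney's
  formula: the chromatic polynomial is the sum of \<open>M(\<pi>) q\<^sup>|\<^sup>\<pi>\<^sup>|\<close> over the bond lattice.
  Fix an edge \<open>e\<close> inside a part of \<open>\<pi>\<close>. Toggling \<open>e\<close> cancels all \<open>F\<close> in \<open>M(\<pi>)\<close> except
  those in which \<open>e\<close> is a bridge, so \<open>M(\<pi>)\<close> is minus the sum of \<open>M(\<pi>')\<close> over the
  \<open>\<pi>'\<close> covered by \<open>\<pi>\<close> whose two merged parts are joined by \<open>e\<close>. Averaging uniformly over
  the edges in a part, and then over the non-singleton parts, turns this into the recursion
  \<open>M(\<pi>) = - \<Sum> w(\<pi>, \<pi>') M(\<pi>')\<close>. A walk of length \<open>k\<close> from \<open>\<pi>\<close> descends to the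
  bottom in \<open>|V| - |\<pi>|\<close> steps and loops there, so for \<open>k\<close> at least this number the
  \<open>\<pi>\<close>-entry of \<open>Z\<^sup>k \<zeta>\<close> is \<open>M(\<pi>) q\<^sup>k\<^sup>-\<^sup>|\<^sup>V\<^sup>|\<^sup>+\<^sup>|\<^sup>\<pi>\<^sup>|\<close>.
\<close>

section \<open>Connected sets and parts of a partition\<close>

lemma partition_on_part_eq:
  "partition_on V \<pi> \<Longrightarrow> S \<in> \<pi> \<Longrightarrow> T \<in> \<pi> \<Longrightarrow> x \<in> S \<Longrightarrow> x \<in> T \<Longrightarrow> S = T"
  by (auto simp: partition_on_def disjoint_def)

lemma connected_set_mono:
  assumes "connected_set F S" "F \<subseteq> F'"
  shows "connected_set F' S"
proof -
  have "{(x, y). x \<in> S \<and> y \<in> S \<and> {x, y} \<in> F}\<^sup>* \<subseteq> {(x, y). x \<in> S \<and> y \<in> S \<and> {x, y} \<in> F'}\<^sup>*"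
    using assms(2) by (intro rtrancl_mono) auto
  with assms(1) show ?thesis unfolding connected_set_def by blast
qed

lemma connected_set_singleton: "connected_set F {v}"
  by (auto simp: connected_set_def)

text \<open>Every point of the union is reached from \<open>u\<close>, by way of \<open>v\<close> if
  it lies in \<open>B\<close>. The edge relation is symmetric, so any two points are joined through
  \<open>u\<close>.\<close>

lemma connected_set_Un:
  assumes A: "connected_set F A" and B: "connected_set F B"
    and uv: "u \<in> A" "v \<in> B" "{u, v} \<in> F"
  shows "connected_set F (A \<union> B)"
proof -
  define R where "R S = {(x, y). x \<in> S \<and> y \<in> S \<and> {x, y} \<in> F}" for S :: "'a set"
  have mono: "(R S)\<^sup>* \<subseteq> (R (A \<union> B))\<^sup>*" if "S \<subseteq> A \<union> B" for S
    using that by (intro rtrancl_mono) (auto simp: R_def)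
  have "sym ((R (A \<union> B))\<^sup>*)"
    by (rule sym_rtrancl) (auto simp: sym_def R_def insert_commute)
  then have sym: "(y, x) \<in> (R (A \<union> B))\<^sup>*" if "(x, y) \<in> (R (A \<union> B))\<^sup>*" for x y
    using that by (auto simp: sym_def)
  have "(u, v) \<in> (R (A \<union> B))\<^sup>*"
    using uv by (intro r_into_rtrancl) (auto simp: R_def)
  moreover have "(u, x) \<in> (R (A \<union> B))\<^sup>*" if "x \<in> A" for x
    using A uv(1) that mono[of A] by (auto simp: connected_set_def R_def)
  moreover have "(v, x) \<in> (R (A \<union> B))\<^sup>*" if "x \<in> B" for x
    using B uv(2) that mono[of B] by (auto simp: connected_set_def R_def)
  ultimately have u: "(u, x) \<in> (R (A \<union> B))\<^sup>*" if "x \<in> A \<union> B" for x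
    using that by (meson UnE rtrancl_trans)
  have "(x, y) \<in> (R (A \<union> B))\<^sup>*" if "x \<in> A \<union> B" "y \<in> A \<union> B" for x y
    using sym[OF u[OF that(1)]] u[OF that(2)] by (rule rtrancl_trans)
  with uv(1) show ?thesis
    unfolding connected_set_def R_def by blast
qed

text \<open>Induction along a path in \<open>S\<close> that starts at \<open>x\<close>. The direct
  form compares components; the contrapositive produces an edge of \<open>S\<close> that leaves
  \<open>T\<close>.\<close>

lemma connected_set_closed:
  assumes S: "connected_set F S" and x: "x \<in> S" "x \<in> T"
    and closed: "\<And>y z. y \<in> S \<Longrightarrow> z \<in> S \<Longrightarrow> {y, z} \<in> F \<Longrightarrow> y \<in> T \<Longrightarrow> z \<in> T"
  shows "S \<subseteq> T"
proof
  fix z assume "z \<in> S"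
  with S x have "(x, z) \<in> {(x, y). x \<in> S \<and> y \<in> S \<and> {x, y} \<in> F}\<^sup>*"
    by (auto simp: connected_set_def)
  then show "z \<in> T"
    by (induction rule: rtrancl_induct) (use x closed in auto)
qed

section \<open>Component partition of an edge set\<close>

text \<open>Connectedness is measured with the edges of \<open>F\<close> alone. The first conjunct
  keeps the parts from being too large, the second from being too small. The relational form allows
  existence and uniqueness to be settled before the function \<open>components\<close> is
  introduced.\<close>

definition components_of :: "'a set \<Rightarrow> 'a set set \<Rightarrow> 'a set set \<Rightarrow> bool" where
  "components_of V F \<pi> \<longleftrightarrow> \<pi> \<in> bond_lattice V F \<and> (\<forall>e\<in>F. \<exists>S\<in>\<pi>. e \<subseteq> S)"

lemma bond_lattice_mono: "F \<subseteq> E \<Longrightarrow> bond_lattice V F \<subseteq> bond_lattice V E"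
  by (auto simp: bond_lattice_def intro: connected_set_mono)

text \<open>Two parts that share a point contain each other: a part connected in \<open>F\<close>
  cannot leave a part that no edge of \<open>F\<close> leaves. By symmetry the inclusion already
  gives uniqueness.\<close>

lemma components_of_subset:
  assumes "components_of V F \<pi>" "components_of V F \<pi>'"
  shows "\<pi> \<subseteq> \<pi>'"
proof -
  have sub: "S \<subseteq> T" if "components_of V F \<rho>" "components_of V F \<rho>'"
      "S \<in> \<rho>" "T \<in> \<rho>'" "x \<in> S" "x \<in> T" for \<rho> \<rho>' S T x
  proof (rule connected_set_closed[where x = x and F = F])
    show "connected_set F S" using that by (auto simp: components_of_def bond_lattice_def)
  next
    fix y z assume "{y, z} \<in> F" "y \<in> T"
    then obtain T' where "T' \<in> \<rho>'" "{y, z} \<subseteq> T'"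
      using \<open>components_of V F \<rho>'\<close> by (metis components_of_def)
    with \<open>y \<in> T\<close> \<open>components_of V F \<rho>'\<close> \<open>T \<in> \<rho>'\<close> show "z \<in> T"
      using partition_on_part_eq[of V \<rho>' T T' y] by (auto simp: components_of_def bond_lattice_def)
  qed (use that in auto)
  show ?thesis
  proof
    fix S assume S: "S \<in> \<pi>"
    have P: "partition_on V \<pi>" "partition_on V \<pi>'"
      using assms by (auto simp: components_of_def bond_lattice_def)
    obtain x where x: "x \<in> S" using S P by (metis all_not_in_conv partition_onD3)
    then have "x \<in> V" using S P by (auto simp: partition_on_def)
    then obtain T where T: "T \<in> \<pi>'" "x \<in> T" using P by (auto simp: partition_on_def)
    have "S = T"
      using sub[OF assms S T(1) x T(2)] sub[OF assms(2,1) T(1) S T(2) x] by simp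
    with T show "S \<in> \<pi>'" by simp
  qed
qed

lemma components_of_unique:
  "components_of V F \<pi> \<Longrightarrow> components_of V F \<pi>' \<Longrightarrow> \<pi> = \<pi>'"
  using components_of_subset by blast

text \<open>The effect on components of adding the edge \<open>e\<close>. Phrased through the parts
  that \<open>e\<close> meets, it requires no choice of endpoints and also covers an edge inside a
  single part, where nothing changes.\<close>

definition merge :: "'a set set \<Rightarrow> 'a set \<Rightarrow> 'a set set" where
  "merge \<pi> e = insert (\<Union>{X\<in>\<pi>. X \<inter> e \<noteq> {}}) {X\<in>\<pi>. X \<inter> e = {}}"

lemma merge_eq:
  assumes "partition_on V \<pi>" "A \<in> \<pi>" "B \<in> \<pi>" "u \<in> A" "v \<in> B"
  shows "merge \<pi> {u, v} = insert (A \<union> B) (\<pi> - {A, B})"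
proof -
  have "X \<inter> {u, v} \<noteq> {} \<longleftrightarrow> X = A \<or> X = B" if "X \<in> \<pi>" for X
    using assms that partition_on_part_eq[OF assms(1)] by blast
  then have "{X\<in>\<pi>. X \<inter> {u, v} \<noteq> {}} = {A, B}" "{X\<in>\<pi>. X \<inter> {u, v} = {}} = \<pi> - {A, B}"
    using assms(2,3) by blast+
  then show ?thesis by (simp add: merge_def)
qed

lemma edge_parts:
  assumes "simple_graph V E" "e \<in> E" "partition_on V \<pi>"
  obtains u v A B where "e = {u, v}" "A \<in> \<pi>" "B \<in> \<pi>" "u \<in> A" "v \<in> B"
proof -
  have "e \<subseteq> V" "card e = 2" using assms by (auto simp: simple_graph_def)
  then obtain u v where "e = {u, v}" "u \<in> V" "v \<in> V" by (auto simp: card_2_iff)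
  with assms(3) that show ?thesis unfolding partition_on_def by blast
qed

lemma partition_on_merge:
  assumes "simple_graph V E" "e \<in> E" "partition_on V \<pi>"
  shows "partition_on V (merge \<pi> e)"
proof -
  obtain u v A B where *: "e = {u, v}" "A \<in> \<pi>" "B \<in> \<pi>" "u \<in> A" "v \<in> B"
    using edge_parts[OF assms] .
  show ?thesis
    unfolding \<open>e = {u, v}\<close> merge_eq[OF assms(3) *(2-5)]
    using assms(3) *(2-5) by (auto simp: partition_on_def disjoint_def)
qed

lemma merge_in_bond_lattice:
  assumes "simple_graph V E" "e \<in> E" "\<pi> \<in> bond_lattice V E"
  shows "merge \<pi> e \<in> bond_lattice V E"
proof -
  have P: "partition_on V \<pi>" using assms by (simp add: bond_lattice_def)
  obtain u v A B where *: "e = {u, v}" "A \<in> \<pi>" "B \<in> \<pi>" "u \<in> A" "v \<in> B"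
    using edge_parts[OF assms(1,2) P] .
  have "connected_set E (A \<union> B)"
    using * assms by (intro connected_set_Un[of E A B u v]) (auto simp: bond_lattice_def)
  then have "\<forall>S\<in>merge \<pi> e. connected_set E S"
    unfolding \<open>e = {u, v}\<close> merge_eq[OF P *(2-5)] using assms(3) by (auto simp: bond_lattice_def)
  with partition_on_merge[OF assms(1,2) P] show ?thesis by (simp add: bond_lattice_def)
qed

text \<open>Old parts stay connected when an edge is added, and the two parts at the ends of
  \<open>e\<close> are connected through it. Each old edge lies in an old part, hence in a part of
  the merged partition.\<close>

lemma components_of_insert:
  assumes "simple_graph V (insert e F)" "components_of V F \<pi>"
  shows "components_of V (insert e F) (merge \<pi> e)"
proof -
  have P: "partition_on V \<pi>" using assms by (simp add: components_of_def bond_lattice_def)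
  obtain u v A B where *: "e = {u, v}" "A \<in> \<pi>" "B \<in> \<pi>" "u \<in> A" "v \<in> B"
    using edge_parts[OF assms(1) insertI1 P] .
  have "\<pi> \<in> bond_lattice V (insert e F)"
    using assms(2) bond_lattice_mono[of F "insert e F"] by (auto simp: components_of_def)
  then have "merge \<pi> e \<in> bond_lattice V (insert e F)"
    using merge_in_bond_lattice[OF assms(1)] by blast
  moreover have "\<exists>S\<in>merge \<pi> e. X \<subseteq> S" if "X \<in> insert e F" for X
  proof -
    have "\<exists>S\<in>merge \<pi> e. T \<subseteq> S" if "T \<in> \<pi>" for T
      unfolding \<open>e = {u, v}\<close> merge_eq[OF P *(2-5)] using that by auto
    moreover have "\<exists>S\<in>merge \<pi> e. e \<subseteq> S"
      unfolding \<open>e = {u, v}\<close> merge_eq[OF P *(2-5)] using * by auto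
    ultimately show ?thesis
      using \<open>X \<in> insert e F\<close> assms(2) unfolding components_of_def by (metis insertE subset_trans)
  qed
  ultimately show ?thesis by (auto simp: components_of_def)
qed

lemma bond_bot_in_bond_lattice: "bond_bot V \<in> bond_lattice V E"
  by (auto simp: bond_lattice_def bond_bot_def partition_on_singletons connected_set_singleton)

lemma simple_graph_mono: "simple_graph V E \<Longrightarrow> F \<subseteq> E \<Longrightarrow> simple_graph V F"
  by (auto simp: simple_graph_def)

lemma simple_graph_finite_edges: "simple_graph V E \<Longrightarrow> finite E"
  unfolding simple_graph_def by (auto intro: finite_subset[of E "Pow V"])

lemma components_of_exists:
  assumes "simple_graph V F"
  shows "\<exists>\<pi>. components_of V F \<pi>"
  using simple_graph_finite_edges[OF assms] assms
proof (induction F)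
  case empty
  have "components_of V {} (bond_bot V)"
    by (simp add: components_of_def bond_bot_in_bond_lattice)
  then show ?case by blast
next
  case (insert e F)
  then show ?case using components_of_insert simple_graph_mono by (metis subset_insertI)
qed

definition components :: "'a set \<Rightarrow> 'a set set \<Rightarrow> 'a set set" where
  "components V F = (THE \<pi>. components_of V F \<pi>)"

lemma components_eqI: "components_of V F \<pi> \<Longrightarrow> components V F = \<pi>"
  unfolding components_def by (metis components_of_unique the_equality)

lemma components_of_components: "simple_graph V F \<Longrightarrow> components_of V F (components V F)"
  using components_of_exists components_eqI by metis

lemma components_insert:
  "simple_graph V (insert e F) \<Longrightarrow> components V (insert e F) = merge (components V F) e"
  by (intro components_eqI components_of_insert components_of_components)
    (auto intro: simple_graph_mono)

lemma components_in_bond_lattice: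
  "simple_graph V E \<Longrightarrow> F \<subseteq> E \<Longrightarrow> components V F \<in> bond_lattice V E"
  using components_of_components[of V F] bond_lattice_mono[of F E V] simple_graph_mono[of V E F]
  unfolding components_of_def by blast

lemma merge_within:
  assumes "partition_on V \<pi>" "e \<noteq> {}" "S \<in> \<pi>" "e \<subseteq> S"
  shows "merge \<pi> e = \<pi>"
proof -
  have "X \<inter> e \<noteq> {} \<longleftrightarrow> X = S" if "X \<in> \<pi>" for X
    using assms that partition_on_part_eq[OF assms(1)] by blast
  then have "{X\<in>\<pi>. X \<inter> e \<noteq> {}} = {S}" "{X\<in>\<pi>. X \<inter> e = {}} = \<pi> - {S}"
    using assms(3) by blast+
  then show ?thesis using assms(3) by (auto simp: merge_def)
qed

section \<open>Whitney's expansion of the chromatic polynomial\<close>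

text \<open>A map constant on the parts amounts to a free choice of one value per part;
  \<open>rep\<close> reads that value off and \<open>part\<close> spreads it out again.\<close>

lemma card_constant_on_parts:
  assumes P: "partition_on V \<pi>" and fin: "finite V"
  shows "card {c \<in> V \<rightarrow>\<^sub>E T. \<forall>S\<in>\<pi>. \<forall>u\<in>S. \<forall>v\<in>S. c u = c v} = card T ^ card \<pi>" (is "card ?C = _")
proof -
  define part where "part v = (THE S. S \<in> \<pi> \<and> v \<in> S)" for v
  define rep where "rep S = (SOME v. v \<in> S)" for S :: "'a set"
  have part: "part v = S" if "S \<in> \<pi>" "v \<in> S" for v S
    unfolding part_def
    using that partition_on_part_eq[OF P] by (metis (mono_tags, lifting) the_equality)
  have part_in: "part v \<in> \<pi>" "v \<in> part v" if v: "v \<in> V" for v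
  proof -
    obtain S where "S \<in> \<pi>" "v \<in> S" using v partition_onD1[OF P] by blast
    with part[OF this] show "part v \<in> \<pi>" "v \<in> part v" by simp_all
  qed
  have rep: "rep S \<in> S" if "S \<in> \<pi>" for S
  proof -
    have "S \<noteq> {}" using that partition_onD3[OF P] by blast
    then show ?thesis by (simp add: rep_def some_in_eq)
  qed
  have inV: "v \<in> V" if "S \<in> \<pi>" "v \<in> S" for S v
    using that partition_onD1[OF P] by blast
  have rep_part: "part (rep S) = S" "rep S \<in> V" if "S \<in> \<pi>" for S
    using that rep part inV by blast+
  have "bij_betw (\<lambda>c. \<lambda>S\<in>\<pi>. c (rep S)) ?C (\<pi> \<rightarrow>\<^sub>E T)"
  proof (rule bij_betw_byWitness[where f' = "\<lambda>f. \<lambda>v\<in>V. f (part v)"])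
    show "\<forall>c\<in>?C. (\<lambda>v\<in>V. (\<lambda>S\<in>\<pi>. c (rep S)) (part v)) = c"
    proof
      fix c assume c: "c \<in> ?C"
      show "(\<lambda>v\<in>V. (\<lambda>S\<in>\<pi>. c (rep S)) (part v)) = c"
      proof
        fix v
        show "(\<lambda>v\<in>V. (\<lambda>S\<in>\<pi>. c (rep S)) (part v)) v = c v"
        proof (cases "v \<in> V")
          case True
          have "c (rep (part v)) = c v" using c part_in[OF True] rep by blast
          then show ?thesis using True part_in by simp
        next
          case False
          then show ?thesis using c PiE_arb[of c V "\<lambda>_. T"] by simp
        qed
      qed
    qed
    show "\<forall>f\<in>\<pi> \<rightarrow>\<^sub>E T. (\<lambda>S\<in>\<pi>. (\<lambda>v\<in>V. f (part v)) (rep S)) = f"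
    proof
      fix f assume f: "f \<in> \<pi> \<rightarrow>\<^sub>E T"
      show "(\<lambda>S\<in>\<pi>. (\<lambda>v\<in>V. f (part v)) (rep S)) = f"
        using PiE_arb[OF f] by (auto simp: fun_eq_iff rep_part)
    qed
    show "(\<lambda>c. \<lambda>S\<in>\<pi>. c (rep S)) ` ?C \<subseteq> \<pi> \<rightarrow>\<^sub>E T"
      by (auto simp: rep_part)
    show "(\<lambda>f. \<lambda>v\<in>V. f (part v)) ` (\<pi> \<rightarrow>\<^sub>E T) \<subseteq> ?C"
    proof (rule image_subsetI, intro CollectI conjI ballI)
      fix f assume f: "f \<in> \<pi> \<rightarrow>\<^sub>E T"
      then show "(\<lambda>v\<in>V. f (part v)) \<in> V \<rightarrow>\<^sub>E T" using part_in by auto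
      fix S u v assume "S \<in> \<pi>" "u \<in> S" "v \<in> S"
      then show "(\<lambda>v\<in>V. f (part v)) u = (\<lambda>v\<in>V. f (part v)) v"
        using part inV by simp
    qed
  qed
  then have "card ?C = card (\<pi> \<rightarrow>\<^sub>E T)" by (rule bij_betw_same_card)
  also have "\<dots> = card T ^ card \<pi>"
    using finite_elements[OF fin P] by (rule card_funcsetE)
  finally show ?thesis .
qed

text \<open>Equality of colors propagates along paths inside a part; conversely, every edge lies
  within one part.\<close>

lemma constant_on_edges_iff:
  assumes "components_of V F \<pi>"
  shows "(\<forall>e\<in>F. \<forall>u\<in>e. \<forall>v\<in>e. c u = c v) \<longleftrightarrow> (\<forall>S\<in>\<pi>. \<forall>u\<in>S. \<forall>v\<in>S. c u = c v)"
proof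
  assume const: "\<forall>e\<in>F. \<forall>u\<in>e. \<forall>v\<in>e. c u = c v"
  show "\<forall>S\<in>\<pi>. \<forall>u\<in>S. \<forall>v\<in>S. c u = c v"
  proof (intro ballI)
    fix S u v assume S: "S \<in> \<pi>" "u \<in> S" "v \<in> S"
    have "S \<subseteq> {x. c u = c x}"
    proof (rule connected_set_closed[where F = F and x = u])
      show "connected_set F S"
        using assms S by (auto simp: components_of_def bond_lattice_def)
    next
      fix y z assume "{y, z} \<in> F" "y \<in> {x. c u = c x}"
      moreover from this const have "c y = c z" by (meson insertCI)
      ultimately show "z \<in> {x. c u = c x}" by simp
    qed (use S in auto)
    then show "c u = c v" using S by auto
  qed
next
  assume "\<forall>S\<in>\<pi>. \<forall>u\<in>S. \<forall>v\<in>S. c u = c v"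
  with assms show "\<forall>e\<in>F. \<forall>u\<in>e. \<forall>v\<in>e. c u = c v"
    unfolding components_of_def by (meson subsetD)
qed

lemma card_constant_on_edges:
  assumes "simple_graph V F"
  shows "card {c \<in> V \<rightarrow>\<^sub>E T. \<forall>e\<in>F. \<forall>u\<in>e. \<forall>v\<in>e. c u = c v} = card T ^ card (components V F)"
proof -
  have C: "components_of V F (components V F)"
    using assms by (rule components_of_components)
  then have P: "partition_on V (components V F)"
    by (simp add: components_of_def bond_lattice_def)
  show ?thesis
    unfolding constant_on_edges_iff[OF C]
    using P assms by (intro card_constant_on_parts) (simp_all add: simple_graph_def)
qed

text \<open>Inclusion-exclusion over the monochromatic edges. Once the product is expanded and the
  sums are swapped, the colorings that belong to \<open>F\<close> are those constant on each
  component of \<open>F\<close>.\<close>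

lemma card_proper_colorings:
  assumes "simple_graph V E"
  shows "(of_nat (card (proper_colorings V E q)) :: rat)
    = (\<Sum>F\<in>Pow E. (-1) ^ card F * of_nat q ^ card (components V F))"
proof -
  define C where "C = V \<rightarrow>\<^sub>E {..<q}"
  define mono where "mono c e \<longleftrightarrow> (\<forall>u\<in>e. \<forall>v\<in>e. c u = c v)" for c :: "'a \<Rightarrow> nat" and e
  have finE: "finite E" using assms by (rule simple_graph_finite_edges)
  have finC: "finite C"
    using assms unfolding C_def simple_graph_def by (intro finite_PiE) auto
  have count: "of_nat (card {c \<in> C. P c}) = (\<Sum>c\<in>C. of_bool (P c) :: rat)" for P
    using finC by (simp add: of_bool_def sum.If_cases Int_def)
  have prod_mono: "(\<Prod>e\<in>F. of_bool (mono c e)) = (of_bool (\<forall>e\<in>F. mono c e) :: rat)"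
    if "finite F" for F c
    using that by induction auto
  have proper: "(\<Prod>e\<in>E. 1 - of_bool (mono c e)) = (of_bool (\<forall>e\<in>E. \<not> mono c e) :: rat)" for c
    using finE by induction auto
  \<comment> \<open>Every edge has the form \<open>{u, v}\<close>, so the condition on pairs of
    vertices turns into one on edges, ready for a product over \<open>E\<close>.\<close>
  have "(\<forall>u v. {u, v} \<in> E \<longrightarrow> c u \<noteq> c v) \<longleftrightarrow> (\<forall>e\<in>E. \<not> mono c e)" for c
  proof -
    have "mono c {u, v} \<longleftrightarrow> c u = c v" for u v by (auto simp: mono_def)
    moreover have "\<exists>u v. e = {u, v}" if "e \<in> E" for e
      using that assms unfolding simple_graph_def card_2_iff by metis
    ultimately show ?thesis by metis
  qed
  then have "proper_colorings V E q = {c \<in> C. \<forall>e\<in>E. \<not> mono c e}"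
    by (simp add: proper_colorings_def C_def)
  then have "(of_nat (card (proper_colorings V E q)) :: rat)
      = (\<Sum>c\<in>C. \<Prod>e\<in>E. 1 - of_bool (mono c e))"
    by (simp add: proper count)
  also have "\<dots> = (\<Sum>c\<in>C. \<Sum>F\<in>Pow E. (-1) ^ card F * of_bool (\<forall>e\<in>F. mono c e))"
  proof (intro sum.cong refl)
    fix c
    have "(\<Prod>e\<in>E. 1 - of_bool (mono c e)) = (\<Sum>F\<in>Pow E. (-1) ^ card F * (\<Prod>e\<in>F. of_bool (mono c e)) :: rat)"
      using prod_diff_conv_sum[OF finE, of "\<lambda>_. 1" "\<lambda>e. of_bool (mono c e)"] by simp
    also have "\<dots> = (\<Sum>F\<in>Pow E. (-1) ^ card F * of_bool (\<forall>e\<in>F. mono c e))"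
      using finE by (intro sum.cong refl) (metis PowD finite_subset prod_mono)
    finally show "(\<Prod>e\<in>E. 1 - of_bool (mono c e))
        = (\<Sum>F\<in>Pow E. (-1) ^ card F * of_bool (\<forall>e\<in>F. mono c e) :: rat)" .
  qed
  also have "\<dots> = (\<Sum>F\<in>Pow E. \<Sum>c\<in>C. (-1) ^ card F * of_bool (\<forall>e\<in>F. mono c e))"
    by (rule sum.swap)
  also have "\<dots> = (\<Sum>F\<in>Pow E. (-1) ^ card F * of_nat q ^ card (components V F))"
  proof (intro sum.cong refl)
    fix F assume "F \<in> Pow E"
    then have "simple_graph V F" using simple_graph_mono[OF assms] by simp
    from card_constant_on_edges[OF this, of "{..<q}"]
    have "card {c \<in> C. \<forall>e\<in>F. mono c e} = q ^ card (components V F)"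
      by (simp add: mono_def C_def)
    moreover have "(\<Sum>c\<in>C. of_bool (\<forall>e\<in>F. mono c e)) = (of_nat (card {c \<in> C. \<forall>e\<in>F. mono c e}) :: rat)"
      by (rule count[symmetric])
    ultimately show "(\<Sum>c\<in>C. (-1) ^ card F * of_bool (\<forall>e\<in>F. mono c e))
        = ((-1) ^ card F * of_nat q ^ card (components V F) :: rat)"
      by (simp add: sum_distrib_left[symmetric])
  qed
  finally show ?thesis .
qed

text \<open>This is \<open>M(\<pi>)\<close>. For \<open>\<pi>\<close> in the bond lattice of a
  simple graph it is the value of the Moebius function of that lattice on the interval from the
  bottom to \<open>\<pi>\<close>.\<close>

definition bond_coeff :: "'a set \<Rightarrow> 'a set set \<Rightarrow> 'a set set \<Rightarrow> rat" where
  "bond_coeff V E \<pi> = (\<Sum>F | F \<subseteq> E \<and> components V F = \<pi>. (-1) ^ card F)"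

lemma finite_bond_lattice: "finite V \<Longrightarrow> finite (bond_lattice V E)"
  by (rule finite_subset[of _ "Pow (Pow V)"]) (auto simp: bond_lattice_def partition_on_def)

lemma chromatic_polynomial_eq_sum:
  assumes "simple_graph V E"
  shows "chromatic_polynomial V E = (\<Sum>\<pi>\<in>bond_lattice V E. monom (bond_coeff V E \<pi>) (card \<pi>))"
proof (rule chromatic_polynomial_unique)
  show "\<forall>q>0. poly (chromatic_polynomial V E) (of_nat q) = of_nat (card (proper_colorings V E q))"
    using poly_chromatic_polynomial[OF assms] by blast
  have finV: "finite V" using assms by (simp add: simple_graph_def)
  have finE: "finite E" using assms by (rule simple_graph_finite_edges)
  show "\<forall>q>0. poly (\<Sum>\<pi>\<in>bond_lattice V E. monom (bond_coeff V E \<pi>) (card \<pi>)) (of_nat q)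
      = of_nat (card (proper_colorings V E q))"
  proof (intro allI impI)
    fix q :: nat
    have "poly (\<Sum>\<pi>\<in>bond_lattice V E. monom (bond_coeff V E \<pi>) (card \<pi>)) (of_nat q)
        = (\<Sum>\<pi>\<in>bond_lattice V E. \<Sum>F | F \<in> Pow E \<and> components V F = \<pi>.
             (-1) ^ card F * of_nat q ^ card (components V F))"
      by (auto simp: poly_sum poly_monom bond_coeff_def sum_distrib_right intro!: sum.cong)
    \<comment> \<open>Each \<open>F\<close> is counted exactly once, under its own component
      partition.\<close>
    also have "\<dots> = (\<Sum>F\<in>Pow E. (-1) ^ card F * of_nat q ^ card (components V F))"
      using components_in_bond_lattice[OF assms] finE finite_bond_lattice[OF finV]
      by (intro sum.group) auto
    also have "\<dots> = of_nat (card (proper_colorings V E q))"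
      using card_proper_colorings[OF assms] by simp
    finally show "poly (\<Sum>\<pi>\<in>bond_lattice V E. monom (bond_coeff V E \<pi>) (card \<pi>)) (of_nat q)
      = of_nat (card (proper_colorings V E q))" .
  qed
qed

section \<open>Covering relations as merges along an edge\<close>

lemma merge_neqE:
  assumes "simple_graph V E" "e \<in> E" "partition_on V \<pi>'" "merge \<pi>' e \<noteq> \<pi>'"
  obtains u v A B where "e = {u, v}" "u \<in> A" "v \<in> B" "A \<in> \<pi>'" "B \<in> \<pi>'" "A \<noteq> B" "A \<inter> B = {}"
    "merge \<pi>' e = insert (A \<union> B) (\<pi>' - {A, B})" "A \<union> B \<notin> \<pi>'"
proof -
  obtain u v A B where *: "e = {u, v}" "A \<in> \<pi>'" "B \<in> \<pi>'" "u \<in> A" "v \<in> B"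
    using edge_parts[OF assms(1-3)] .
  have merge: "merge \<pi>' e = insert (A \<union> B) (\<pi>' - {A, B})"
    using merge_eq[OF assms(3) *(2-5)] *(1) by simp
  have neq: "A \<noteq> B" using merge assms(4) *(2) by auto
  then have disj: "A \<inter> B = {}"
    using *(2,3) assms(3) by (auto simp: partition_on_def disjoint_def)
  have "A \<union> B \<notin> \<pi>'"
  proof
    assume "A \<union> B \<in> \<pi>'"
    then have "A \<union> B = A" using partition_on_part_eq[OF assms(3) _ *(2)] *(4) by blast
    then show False using disj *(5) by blast
  qed
  with * merge neq disj that show ?thesis by blast
qed

lemma refines_merge:
  assumes "simple_graph V E" "e \<in> E" "partition_on V \<pi>'"
  shows "refines V \<pi>' (merge \<pi>' e)"
proof (cases "merge \<pi>' e = \<pi>'")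
  case True
  then show ?thesis using refines_refl[OF assms(3)] by simp
next
  case False
  from merge_neqE[OF assms False] obtain A B where "merge \<pi>' e = insert (A \<union> B) (\<pi>' - {A, B})"
    by metis
  moreover have "partition_on V (merge \<pi>' e)" using assms by (rule partition_on_merge)
  ultimately show ?thesis using assms(3) by (auto simp: refines_def)
qed

lemma card_merge:
  assumes "simple_graph V E" "e \<in> E" "partition_on V \<pi>'" "merge \<pi>' e \<noteq> \<pi>'"
  shows "card \<pi>' = Suc (card (merge \<pi>' e))"
proof -
  obtain u v A B where *: "A \<in> \<pi>'" "B \<in> \<pi>'" "A \<noteq> B" "A \<union> B \<notin> \<pi>'"
    "merge \<pi>' e = insert (A \<union> B) (\<pi>' - {A, B})"
    using merge_neqE[OF assms] by metis
  have fin: "finite \<pi>'"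
    using assms finite_elements by (auto simp: simple_graph_def)
  \<comment> \<open>This bound makes the natural-number subtraction in the next step exact.\<close>
  have "card {A, B} \<le> card \<pi>'" using fin * by (intro card_mono) auto
  moreover have "card (\<pi>' - {A, B}) = card \<pi>' - card {A, B}"
    using * by (intro card_Diff_subset) auto
  ultimately show ?thesis using * fin by simp
qed

text \<open>A partition \<open>\<rho>\<close> between the two either has \<open>A\<close> and
  \<open>B\<close> in one part, and is then refined by the merged partition, or has them in
  different parts, and then refines \<open>\<pi>'\<close>.\<close>

lemma bond_coversI:
  assumes G: "simple_graph V E" and L: "\<pi>' \<in> bond_lattice V E"
    and e: "e \<in> E" and neq: "merge \<pi>' e \<noteq> \<pi>'"
  shows "bond_covers V E (merge \<pi>' e) \<pi>'"
proof -
  let ?\<pi> = "merge \<pi>' e"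
  have P: "partition_on V \<pi>'" using L by (simp add: bond_lattice_def)
  obtain u v A B where *: "u \<in> A" "v \<in> B" "A \<in> \<pi>'" "B \<in> \<pi>'"
      "A \<noteq> B" "A \<inter> B = {}" "?\<pi> = insert (A \<union> B) (\<pi>' - {A, B})" "A \<union> B \<notin> \<pi>'"
    using merge_neqE[OF G e P neq] by metis
  have "\<rho> = \<pi>' \<or> \<rho> = ?\<pi>" if \<rho>: "refines V \<pi>' \<rho>" "refines V \<rho> ?\<pi>" for \<rho>
  proof -
    have P\<rho>: "partition_on V \<rho>" using \<rho> by (simp add: refines_def)
    obtain R where R: "R \<in> \<rho>" "A \<subseteq> R" using \<rho>(1) *(3) unfolding refines_def by blast
    obtain R' where R': "R' \<in> \<rho>" "B \<subseteq> R'" using \<rho>(1) *(4) unfolding refines_def by blast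
    show ?thesis
    proof (cases "R = R'")
      case True
      have "refines V ?\<pi> \<rho>"
        unfolding refines_def
      proof (intro conjI ballI)
        show "partition_on V ?\<pi>" using \<rho> by (simp add: refines_def)
        fix X assume "X \<in> ?\<pi>"
        then consider "X = A \<union> B" | "X \<in> \<pi>'" using * by auto
        then show "\<exists>Y\<in>\<rho>. X \<subseteq> Y"
        proof cases
          case 1
          with R R' True show ?thesis by blast
        next
          case 2
          with \<rho>(1) show ?thesis unfolding refines_def by blast
        qed
      qed (rule P\<rho>)
      with \<rho>(2) show ?thesis using refines_asym by blast
    next
      case False
      have "refines V \<rho> \<pi>'"
        unfolding refines_def
      proof (intro conjI ballI)
        fix X assume X: "X \<in> \<rho>"
        then obtain Y where Y: "Y \<in> ?\<pi>" "X \<subseteq> Y" using \<rho>(2) unfolding refines_def by blast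
        show "\<exists>Y\<in>\<pi>'. X \<subseteq> Y"
        proof (cases "Y = A \<union> B")
          case True
          \<comment> \<open>A part of \<open>\<rho>\<close> meeting both \<open>A\<close> and
            \<open>B\<close> would equal both \<open>R\<close> and \<open>R'\<close>.\<close>
          have "X \<inter> A = {} \<or> X \<inter> B = {}"
            using False R R' X partition_on_part_eq[OF P\<rho>] by (metis disjoint_iff subsetD)
          then have "X \<subseteq> B \<or> X \<subseteq> A" using Y True by blast
          with * show ?thesis by blast
        next
          case False
          with Y * show ?thesis by blast
        qed
      qed (rule P\<rho>, rule P)
      with \<rho>(1) show ?thesis using refines_asym by blast
    qed
  qed
  then show ?thesis
    unfolding bond_covers_def
    using merge_in_bond_lattice[OF G e L] L neq refines_merge[OF G e P] by auto
qed

text \<open>Some part \<open>S\<close> of \<open>\<pi>\<close> lies in no part of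
  \<open>\<pi>'\<close>. Merging along an edge of \<open>S\<close> that joins two parts of
  \<open>\<pi>'\<close> gives a partition strictly above \<open>\<pi>'\<close> that still refines
  \<open>\<pi>\<close>, so the covering property forces it to be \<open>\<pi>\<close>.\<close>

lemma bond_coversE:
  assumes G: "simple_graph V E" and cov: "bond_covers V E \<pi> \<pi>'"
  obtains e where "e \<in> E" "merge \<pi>' e = \<pi>"
proof -
  have L: "\<pi> \<in> bond_lattice V E" "\<pi>' \<in> bond_lattice V E" and neq: "\<pi>' \<noteq> \<pi>"
    and ref: "refines V \<pi>' \<pi>"
    and min: "\<And>\<rho>. \<rho> \<in> bond_lattice V E \<Longrightarrow> refines V \<pi>' \<rho> \<Longrightarrow> refines V \<rho> \<pi> \<Longrightarrow> \<rho> = \<pi>' \<or> \<rho> = \<pi>"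
    using cov by (auto simp: bond_covers_def)
  have P: "partition_on V \<pi>" "partition_on V \<pi>'" using L by (auto simp: bond_lattice_def)
  have "\<not> refines V \<pi> \<pi>'" using ref neq refines_asym by blast
  then obtain S where S: "S \<in> \<pi>" "\<And>Y. Y \<in> \<pi>' \<Longrightarrow> \<not> S \<subseteq> Y"
    using P by (auto simp: refines_def)
  have sub: "A \<subseteq> S" if "A \<in> \<pi>'" "x \<in> A" "x \<in> S" for A x
  proof -
    obtain T where "T \<in> \<pi>" "A \<subseteq> T" using ref \<open>A \<in> \<pi>'\<close> unfolding refines_def by blast
    with that S(1) show ?thesis using partition_on_part_eq[OF P(1), of T S x] by blast
  qed
  obtain x where x: "x \<in> S" using S(1) partition_onD3[OF P(1)] by (metis all_not_in_conv)
  then have "x \<in> V" using S(1) partition_onD1[OF P(1)] by blast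
  then obtain A where A: "A \<in> \<pi>'" "x \<in> A" using partition_onD1[OF P(2)] by blast
  have "connected_set E S" using L(1) S(1) by (simp add: bond_lattice_def)
  \<comment> \<open>If no edge of \<open>S\<close> left \<open>A\<close>, connectedness would put
    all of \<open>S\<close> inside the part \<open>A\<close> of \<open>\<pi>'\<close>.\<close>
  then obtain y z where yz: "y \<in> S" "z \<in> S" "{y, z} \<in> E" "y \<in> A" "z \<notin> A"
    using connected_set_closed[of E S x A] x A S(2)[of A] by blast
  have "z \<in> V" using yz(2) S(1) partition_onD1[OF P(1)] by blast
  then obtain B where B: "B \<in> \<pi>'" "z \<in> B" using partition_onD1[OF P(2)] by blast
  let ?\<rho> = "merge \<pi>' {y, z}"
  have \<rho>: "?\<rho> = insert (A \<union> B) (\<pi>' - {A, B})"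
    using merge_eq[OF P(2) A(1) B(1) yz(4) B(2)] .
  have "A \<union> B \<notin> \<pi>'"
    using partition_on_part_eq[OF P(2), of "A \<union> B" A y] A(1) yz(4,5) B(2) by blast
  then have "?\<rho> \<noteq> \<pi>'" using \<rho> by blast
  moreover have "refines V ?\<rho> \<pi>"
    unfolding refines_def
  proof (intro conjI ballI)
    show "partition_on V ?\<rho>" using partition_on_merge[OF G yz(3) P(2)] .
    fix X assume "X \<in> ?\<rho>"
    then consider "X = A \<union> B" | "X \<in> \<pi>'" using \<rho> by auto
    then show "\<exists>Y\<in>\<pi>. X \<subseteq> Y"
    proof cases
      case 1
      with sub[OF A x] sub[OF B yz(2)] S(1) show ?thesis by blast
    next
      case 2
      with ref show ?thesis unfolding refines_def by blast
    qed
  qed (rule P(1))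
  ultimately have "?\<rho> = \<pi>"
    using min[OF merge_in_bond_lattice[OF G yz(3) L(2)] refines_merge[OF G yz(3) P(2)]] by blast
  with yz(3) that show ?thesis by blast
qed

lemma bond_covers_iff:
  assumes "simple_graph V E" "\<pi>' \<in> bond_lattice V E"
  shows "bond_covers V E \<pi> \<pi>' \<longleftrightarrow> \<pi>' \<noteq> \<pi> \<and> (\<exists>e\<in>E. merge \<pi>' e = \<pi>)"
  using bond_coversI[OF assms] bond_coversE[OF assms(1), of \<pi> \<pi>']
  by (metis bond_covers_def)

text \<open>The merged partition remembers the pair: \<open>A\<close> and \<open>B\<close> are parts
  of \<open>\<pi>'\<close> missing from it, and merging along an edge removes only the parts at its
  two ends. Thus \<open>edges_between\<close> counts the edges that produce a given cover.\<close>

lemma merge_eq_iff_crossing: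
  assumes G: "simple_graph V E" and P: "partition_on V \<pi>'"
    and AB: "A \<in> \<pi>'" "B \<in> \<pi>'" "A \<noteq> B" and f: "f \<in> E"
  shows "merge \<pi>' f = insert (A \<union> B) (\<pi>' - {A, B}) \<longleftrightarrow> (\<exists>u\<in>A. \<exists>v\<in>B. f = {u, v})"
proof
  assume "\<exists>u\<in>A. \<exists>v\<in>B. f = {u, v}"
  then show "merge \<pi>' f = insert (A \<union> B) (\<pi>' - {A, B})"
    using merge_eq[OF P AB(1,2)] by blast
next
  assume m: "merge \<pi>' f = insert (A \<union> B) (\<pi>' - {A, B})"
  have "A \<inter> B = {}" "A \<noteq> {}" "B \<noteq> {}"
    using AB P by (auto simp: partition_on_def disjoint_def)
  then have notin: "A \<notin> merge \<pi>' f" "B \<notin> merge \<pi>' f" unfolding m by auto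
  then have "merge \<pi>' f \<noteq> \<pi>'" using AB(1) by metis
  from merge_neqE[OF G f P this] obtain u v A' B'
    where *: "f = {u, v}" "u \<in> A'" "v \<in> B'" "merge \<pi>' f = insert (A' \<union> B') (\<pi>' - {A', B'})"
    by metis
  have "A \<in> {A', B'}" "B \<in> {A', B'}" using notin AB unfolding *(4) by auto
  with AB(3) have "A' = A \<and> B' = B \<or> A' = B \<and> B' = A" by auto
  then show "\<exists>u\<in>A. \<exists>v\<in>B. f = {u, v}"
    using * by (metis insert_commute)
qed

section \<open>Recursion for the coefficients\<close>

text \<open>The weight is a probability: draw a non-singleton part \<open>S\<close> of
  \<open>\<pi>\<close> uniformly, then an edge inside \<open>S\<close> uniformly, and ask whether it
  merges \<open>\<pi>'\<close> into \<open>\<pi>\<close>. Only the newly formed part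
  \<open>A \<union> B\<close> contributes.\<close>

lemma bond_weight_eq_sum:
  assumes G: "simple_graph V E" and cov: "bond_covers V E \<pi> \<pi>'"
  shows "bond_weight E \<pi> \<pi>' = (\<Sum>S | S \<in> \<pi> \<and> card S > 1. \<Sum>e | e \<in> E \<and> e \<subseteq> S \<and> merge \<pi>' e = \<pi>.
    1 / of_nat (num_nonsingleton \<pi>) * (1 / of_nat (edges_within E S)))"
proof -
  have L: "\<pi> \<in> bond_lattice V E" "\<pi>' \<in> bond_lattice V E" and neq: "\<pi>' \<noteq> \<pi>"
    using cov by (auto simp: bond_covers_def)
  have P: "partition_on V \<pi>" "partition_on V \<pi>'" using L by (auto simp: bond_lattice_def)
  have finV: "finite V" using G by (simp add: simple_graph_def)
  have fin: "finite \<pi>" using finV P(1) by (rule finite_elements)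
  obtain e where e: "e \<in> E" "merge \<pi>' e = \<pi>" using bond_coversE[OF G cov] .
  then have "merge \<pi>' e \<noteq> \<pi>'" using neq by simp
  from merge_neqE[OF G e(1) P(2) this] obtain u v A B
    where uv: "u \<in> A" "v \<in> B"
      and AB: "A \<in> \<pi>'" "B \<in> \<pi>'" "A \<noteq> B" "A \<inter> B = {}" "\<pi> = insert (A \<union> B) (\<pi>' - {A, B})" "A \<union> B \<notin> \<pi>'"
    using e(2) by metis
  have crossing: "merge \<pi>' f = \<pi> \<longleftrightarrow> (\<exists>u\<in>A. \<exists>v\<in>B. f = {u, v})" if "f \<in> E" for f
    using merge_eq_iff_crossing[OF G P(2) AB(1-3) that] AB(5) by simp
  \<comment> \<open>The merged part contains the distinct points \<open>u\<close> and
    \<open>v\<close>, so it passes the filter \<open>card S > 1\<close>; finiteness makes this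
    comparison of cardinalities valid.\<close>
  have "finite (A \<union> B)"
    using finV P(1) AB(5) by (intro finite_subset[of "A \<union> B" V]) (auto simp: partition_on_def)
  then have "card {u, v} \<le> card (A \<union> B)" using uv by (intro card_mono) auto
  moreover have "u \<noteq> v" using uv AB(4) by auto
  ultimately have big: "card (A \<union> B) > 1" by simp
  define c where "c = (1 / of_nat (num_nonsingleton \<pi>) :: rat)"
  have "(\<Sum>e | e \<in> E \<and> e \<subseteq> S \<and> merge \<pi>' e = \<pi>. c * (1 / of_nat (edges_within E S)))
      = (if S = A \<union> B then c * (of_nat (edges_between E A B) / of_nat (edges_within E S)) else 0)"
    if "S \<in> \<pi>" for S
  proof (cases "S = A \<union> B")
    case True
    then have "{e. e \<in> E \<and> e \<subseteq> S \<and> merge \<pi>' e = \<pi>} = {e \<in> E. \<exists>u\<in>A. \<exists>v\<in>B. e = {u, v}}"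
      using crossing by blast
    with True show ?thesis by (simp add: edges_between_def)
  next
    case False
    have "u \<notin> S" if "u \<in> A" for u
      using that False partition_on_part_eq[OF P(1) \<open>S \<in> \<pi>\<close>, of "A \<union> B" u] AB(5) by blast
    then have "{e. e \<in> E \<and> e \<subseteq> S \<and> merge \<pi>' e = \<pi>} = {}"
      using crossing by blast
    with False show ?thesis by (simp only: sum.empty if_False)
  qed
  then have "(\<Sum>S | S \<in> \<pi> \<and> card S > 1. \<Sum>e | e \<in> E \<and> e \<subseteq> S \<and> merge \<pi>' e = \<pi>.
      c * (1 / of_nat (edges_within E S)))
    = (\<Sum>S | S \<in> \<pi> \<and> card S > 1.
        if S = A \<union> B then c * (of_nat (edges_between E A B) / of_nat (edges_within E S)) else 0)"
    by (intro sum.cong refl) blast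
  also have "\<dots> = c * (of_nat (edges_between E A B) / of_nat (edges_within E (A \<union> B)))"
    using fin big AB(5) by (subst sum.delta) auto
  also have "\<dots> = bond_weight E \<pi> \<pi>'"
    unfolding c_def
    by (rule bond_weight_eq[symmetric]) (use AB in auto)
  finally show ?thesis by (simp add: c_def)
qed

lemma sum_Pow_insert:
  assumes "finite A" "x \<notin> A"
  shows "(\<Sum>X\<in>Pow (insert x A). f X) = (\<Sum>X\<in>Pow A. f X + f (insert x X))"
proof -
  have "inj_on (insert x) (Pow A)" using assms(2) by (auto simp: inj_on_def)
  moreover have "Pow A \<inter> insert x ` Pow A = {}" using assms(2) by auto
  ultimately show ?thesis
    using assms(1) by (simp add: Pow_insert sum.union_disjoint sum.reindex sum.distrib)
qed

text \<open>Pair each \<open>F\<close> avoiding \<open>e\<close> with \<open>insert e F\<close>. The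
  signs cancel if both have component partition \<open>\<pi>\<close>. Since \<open>e\<close> lies
  inside a part of \<open>\<pi>\<close>, the only other contributing pairs are those where
  \<open>e\<close> first creates \<open>\<pi>\<close>, and these leave the sign of
  \<open>insert e F\<close>.\<close>

lemma bond_coeff_merge:
  assumes G: "simple_graph V E" and P: "partition_on V \<pi>"
    and e: "e \<in> E" "S \<in> \<pi>" "e \<subseteq> S"
  shows "bond_coeff V E \<pi>
    = - (\<Sum>\<pi>' | \<pi>' \<in> bond_lattice V E \<and> \<pi>' \<noteq> \<pi> \<and> merge \<pi>' e = \<pi>. bond_coeff V E \<pi>')"
proof -
  have finE: "finite E" using G by (rule simple_graph_finite_edges)
  have finV: "finite V" using G by (simp add: simple_graph_def)
  have "e \<noteq> {}" using G e(1) by (auto simp: simple_graph_def)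
  then have merge_\<pi>: "merge \<pi> e = \<pi>" using merge_within[OF P _ e(2,3)] by simp
  \<comment> \<open>These are the sets for which \<open>e\<close> becomes a bridge whose addition
    completes \<open>\<pi>\<close>.\<close>
  define new where "new F \<longleftrightarrow> components V F \<noteq> \<pi> \<and> merge (components V F) e = \<pi>" for F
  have split: "E = insert e (E - {e})" using e(1) by auto
  have "bond_coeff V E \<pi> = (\<Sum>F\<in>Pow E. if components V F = \<pi> then (-1) ^ card F else 0)"
    unfolding bond_coeff_def using finE by (simp add: sum.inter_filter[symmetric])
  also have "\<dots> = (\<Sum>F\<in>Pow (E - {e}). (if components V F = \<pi> then (-1) ^ card F else 0)
      + (if components V (insert e F) = \<pi> then (-1) ^ card (insert e F) else 0))"
    by (subst split, rule sum_Pow_insert) (use finE in auto)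
  also have "\<dots> = (\<Sum>F\<in>Pow (E - {e}). if new F then - ((-1) ^ card F) else 0)"
  proof (rule sum.cong[OF refl])
    fix F assume F: "F \<in> Pow (E - {e})"
    then have "simple_graph V (insert e F)" using e(1) simple_graph_mono[OF G, of "insert e F"] by auto
    then have "components V (insert e F) = merge (components V F) e"
      by (rule components_insert)
    moreover have "finite F" "e \<notin> F" using F finE by (auto intro: finite_subset)
    ultimately show "(if components V F = \<pi> then (-1) ^ card F else 0)
      + (if components V (insert e F) = \<pi> then (-1) ^ card (insert e F) else 0)
      = (if new F then - ((-1) ^ card F) else (0 :: rat))"
      using merge_\<pi> by (auto simp: new_def)
  qed
  \<comment> \<open>Sets containing \<open>e\<close> may be added for free: \<open>e\<close> already
    lies in one of their components, so merging along it changes nothing and \<open>new\<close>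
    fails.\<close>
  also have "\<dots> = (\<Sum>F\<in>Pow E. if new F then - ((-1) ^ card F) else 0)"
  proof (rule sum.mono_neutral_left)
    show "\<forall>F\<in>Pow E - Pow (E - {e}). (if new F then - ((-1) ^ card F) else (0::rat)) = 0"
    proof
      fix F assume F: "F \<in> Pow E - Pow (E - {e})"
      then have "simple_graph V F" using simple_graph_mono[OF G] by auto
      then have C: "components_of V F (components V F)" by (rule components_of_components)
      moreover have "e \<in> F" using F by auto
      ultimately obtain T where "T \<in> components V F" "e \<subseteq> T"
        by (auto simp: components_of_def)
      then have "merge (components V F) e = components V F"
        using C \<open>e \<noteq> {}\<close> by (intro merge_within) (auto simp: components_of_def bond_lattice_def)
      then have "\<not> new F" by (auto simp: new_def)
      then show "(if new F then - ((-1) ^ card F) else (0::rat)) = 0" by simp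
    qed
  qed (use finE in auto)
  also have "\<dots> = - (\<Sum>F | F \<in> Pow E \<and> new F. (-1) ^ card F)"
    using finE by (simp add: sum.inter_filter[symmetric] sum_negf)
  also have "(\<Sum>F | F \<in> Pow E \<and> new F. (-1) ^ card F)
      = (\<Sum>\<pi>' | \<pi>' \<in> bond_lattice V E \<and> \<pi>' \<noteq> \<pi> \<and> merge \<pi>' e = \<pi>.
          \<Sum>F | F \<in> {F. F \<in> Pow E \<and> new F} \<and> components V F = \<pi>'. (-1) ^ card F)"
    by (rule sum.group[symmetric])
      (use finE finite_bond_lattice[OF finV] components_in_bond_lattice[OF G] in \<open>auto simp: new_def\<close>)
  also have "\<dots> = (\<Sum>\<pi>' | \<pi>' \<in> bond_lattice V E \<and> \<pi>' \<noteq> \<pi> \<and> merge \<pi>' e = \<pi>. bond_coeff V E \<pi>')"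
    by (rule sum.cong[OF refl], unfold bond_coeff_def, rule sum.cong) (auto simp: new_def)
  finally show ?thesis .
qed

lemma num_nonsingleton_pos:
  assumes V: "finite V" and P: "partition_on V \<pi>" and neq: "\<pi> \<noteq> bond_bot V"
  shows "num_nonsingleton \<pi> > 0"
proof (rule ccontr)
  assume "\<not> num_nonsingleton \<pi> > 0"
  then have small: "\<not> card S > 1" if "S \<in> \<pi>" for S
    using that finite_elements[OF V P] by (auto simp: num_nonsingleton_def)
  have pos: "card S > 0" if "S \<in> \<pi>" for S
    using that P V by (auto simp: card_gt_0_iff partition_on_def intro: finite_subset)
  have "card S = 1" if "S \<in> \<pi>" for S
    using small[OF that] pos[OF that] by linarith
  then have sing: "\<exists>v. S = {v}" if "S \<in> \<pi>" for S
    using that by (auto simp: card_1_singleton_iff)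
  have "\<pi> = (\<lambda>v. {v}) ` V"
  proof (intro equalityI subsetI)
    fix S assume "S \<in> \<pi>"
    with sing partition_onD1[OF P] show "S \<in> (\<lambda>v. {v}) ` V" by blast
  next
    fix S assume "S \<in> (\<lambda>v. {v}) ` V"
    then obtain v T where "S = {v}" "T \<in> \<pi>" "v \<in> T" using partition_onD1[OF P] by blast
    with sing[of T] show "S \<in> \<pi>" by auto
  qed
  with neq show False by (simp add: bond_bot_def)
qed

text \<open>Without an edge a single point would be closed under adjacency and exhaust
  \<open>S\<close>. This keeps the denominator \<open>edges_within E S\<close> nonzero.\<close>

lemma connected_set_edge:
  assumes "connected_set E S" "card S > 1"
  shows "\<exists>e\<in>E. e \<subseteq> S"
proof -
  obtain u where u: "u \<in> S" using assms(1) by (auto simp: connected_set_def)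
  have "\<not> S \<subseteq> {u}"
  proof
    assume "S \<subseteq> {u}"
    with u have "S = {u}" by auto
    with assms(2) show False by simp
  qed
  then obtain y z where "y \<in> S" "z \<in> S" "{y, z} \<in> E"
    using connected_set_closed[of E S u "{u}"] assms(1) u by blast
  then show ?thesis by (intro bexI[of _ "{y, z}"]) auto
qed

text \<open>Each pair of a non-singleton part and an edge in it expresses
  \<open>bond_coeff V E \<pi>\<close> by \<open>bond_coeff_merge\<close>. Averaging these
  expressions with the coefficients \<open>c S\<close> and exchanging the sums collects the factor
  \<open>bond_weight E \<pi> \<pi>'\<close> at each \<open>\<pi>'\<close>.\<close>

lemma bond_coeff_recursion:
  assumes G: "simple_graph V E" and L: "\<pi> \<in> bond_lattice V E" and neq: "\<pi> \<noteq> bond_bot V"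
  shows "bond_coeff V E \<pi>
    = - (\<Sum>\<pi>' | \<pi>' \<in> bond_lattice V E \<and> bond_covers V E \<pi> \<pi>'. bond_weight E \<pi> \<pi>' * bond_coeff V E \<pi>')"
proof -
  define D where "D = {S \<in> \<pi>. card S > 1}"
  define C where "C = {\<pi>'. \<pi>' \<in> bond_lattice V E \<and> bond_covers V E \<pi> \<pi>'}"
  define c where "c S = (1 / of_nat (num_nonsingleton \<pi>) * (1 / of_nat (edges_within E S)) :: rat)" for S
  let ?M = "bond_coeff V E"
  have finV: "finite V" using G by (simp add: simple_graph_def)
  have finE: "finite E" using G by (rule simple_graph_finite_edges)
  have P: "partition_on V \<pi>" using L by (simp add: bond_lattice_def)
  have finD: "finite D" using finite_elements[OF finV P] by (simp add: D_def)
  have finC: "finite C" using finite_bond_lattice[OF finV] by (simp add: C_def)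
  have cardD: "card D = num_nonsingleton \<pi>" by (simp add: D_def num_nonsingleton_def)
  \<comment> \<open>The coefficients form a probability distribution on the pairs;
    \<open>\<pi> \<noteq> bond_bot V\<close> ensures that there is a part to choose.\<close>
  have total: "(\<Sum>S\<in>D. \<Sum>e | e \<in> E \<and> e \<subseteq> S. c S) = 1"
  proof -
    have "(\<Sum>e | e \<in> E \<and> e \<subseteq> S. c S) = 1 / of_nat (num_nonsingleton \<pi>)" if "S \<in> D" for S
    proof -
      have "\<exists>e\<in>E. e \<subseteq> S"
        using that L by (intro connected_set_edge) (auto simp: D_def bond_lattice_def)
      then have "edges_within E S \<noteq> 0" using finE by (auto simp: edges_within_def)
      then show ?thesis by (simp add: c_def edges_within_def)
    qed
    then have "(\<Sum>S\<in>D. \<Sum>e | e \<in> E \<and> e \<subseteq> S. c S) = of_nat (card D) * (1 / of_nat (num_nonsingleton \<pi>))"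
      by simp
    then show ?thesis using num_nonsingleton_pos[OF finV P neq] by (simp add: cardD)
  qed
  have toggle: "?M \<pi> = - (\<Sum>\<pi>'\<in>C. if merge \<pi>' e = \<pi> then ?M \<pi>' else 0)"
    if "S \<in> D" "e \<in> E" "e \<subseteq> S" for S e
  proof -
    have "{\<pi>'. \<pi>' \<in> bond_lattice V E \<and> \<pi>' \<noteq> \<pi> \<and> merge \<pi>' e = \<pi>} = {\<pi>' \<in> C. merge \<pi>' e = \<pi>}"
      using bond_covers_iff[OF G] \<open>e \<in> E\<close> by (auto simp: C_def)
    moreover have "S \<in> \<pi>" using \<open>S \<in> D\<close> by (simp add: D_def)
    ultimately show ?thesis
      using bond_coeff_merge[OF G P that(2) _ that(3)] finC by (simp add: sum.inter_filter)
  qed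
  have "?M \<pi> = (\<Sum>S\<in>D. \<Sum>e | e \<in> E \<and> e \<subseteq> S. c S) * ?M \<pi>"
    by (simp only: total mult_1_left)
  also have "\<dots> = (\<Sum>S\<in>D. \<Sum>e | e \<in> E \<and> e \<subseteq> S. c S * ?M \<pi>)"
    by (simp only: sum_distrib_right)
  also have "\<dots> = (\<Sum>S\<in>D. \<Sum>e | e \<in> E \<and> e \<subseteq> S.
      - (\<Sum>\<pi>'\<in>C. (if merge \<pi>' e = \<pi> then c S else 0) * ?M \<pi>'))"
  proof (intro sum.cong refl)
    fix S e assume "S \<in> D" "e \<in> {e. e \<in> E \<and> e \<subseteq> S}"
    then have "c S * ?M \<pi> = c S * - (\<Sum>\<pi>'\<in>C. if merge \<pi>' e = \<pi> then ?M \<pi>' else 0)"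
      using toggle[of S e] by simp
    also have "\<dots> = - (\<Sum>\<pi>'\<in>C. (if merge \<pi>' e = \<pi> then c S else 0) * ?M \<pi>')"
      by (auto simp: sum_distrib_left intro!: sum.cong)
    finally show "c S * ?M \<pi> = - (\<Sum>\<pi>'\<in>C. (if merge \<pi>' e = \<pi> then c S else 0) * ?M \<pi>')" .
  qed
  also have "\<dots> = - (\<Sum>S\<in>D. \<Sum>e | e \<in> E \<and> e \<subseteq> S.
      \<Sum>\<pi>'\<in>C. (if merge \<pi>' e = \<pi> then c S else 0) * ?M \<pi>')"
    by (simp only: sum_negf)
  also have "\<dots> = - (\<Sum>S\<in>D. \<Sum>\<pi>'\<in>C. \<Sum>e | e \<in> E \<and> e \<subseteq> S.
      (if merge \<pi>' e = \<pi> then c S else 0) * ?M \<pi>')"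
    by (intro arg_cong[of _ _ uminus] sum.cong refl sum.swap)
  also have "\<dots> = - (\<Sum>\<pi>'\<in>C. \<Sum>S\<in>D. \<Sum>e | e \<in> E \<and> e \<subseteq> S.
      (if merge \<pi>' e = \<pi> then c S else 0) * ?M \<pi>')"
    by (intro arg_cong[of _ _ uminus] sum.swap)
  also have "\<dots> = - (\<Sum>\<pi>'\<in>C. bond_weight E \<pi> \<pi>' * ?M \<pi>')"
  proof (intro arg_cong[of _ _ uminus] sum.cong refl)
    fix \<pi>' assume "\<pi>' \<in> C"
    then have cov: "bond_covers V E \<pi> \<pi>'" by (simp add: C_def)
    have "(\<Sum>e | e \<in> E \<and> e \<subseteq> S. if merge \<pi>' e = \<pi> then c S else 0)
        = (\<Sum>e | e \<in> E \<and> e \<subseteq> S \<and> merge \<pi>' e = \<pi>. c S)" for S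
    proof -
      have "finite {e. e \<in> E \<and> e \<subseteq> S}" using finE by simp
      moreover have "{e. e \<in> E \<and> e \<subseteq> S \<and> merge \<pi>' e = \<pi>} = {e \<in> {e. e \<in> E \<and> e \<subseteq> S}. merge \<pi>' e = \<pi>}"
        by auto
      ultimately show ?thesis by (simp only: sum.inter_filter)
    qed
    then have "bond_weight E \<pi> \<pi>' = (\<Sum>S\<in>D. \<Sum>e | e \<in> E \<and> e \<subseteq> S. if merge \<pi>' e = \<pi> then c S else 0)"
      using bond_weight_eq_sum[OF G cov] by (simp add: D_def c_def)
    then show "(\<Sum>S\<in>D. \<Sum>e | e \<in> E \<and> e \<subseteq> S. (if merge \<pi>' e = \<pi> then c S else 0) * ?M \<pi>')
        = bond_weight E \<pi> \<pi>' * ?M \<pi>'"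
      by (simp only: sum_distrib_right)
  qed
  finally show ?thesis by (simp only: C_def)
qed

section \<open>Weighted walks down the bond lattice\<close>

text \<open>Only the empty edge set contributes, because an edge has two points and cannot lie in a
  singleton.\<close>

lemma bond_coeff_bot:
  assumes "simple_graph V E"
  shows "bond_coeff V E (bond_bot V) = 1"
proof -
  have "components V F = bond_bot V \<longleftrightarrow> F = {}" if "F \<subseteq> E" for F
  proof
    assume F: "components V F = bond_bot V"
    have "components_of V F (bond_bot V)"
      using components_of_components[OF simple_graph_mono[OF assms that]] F by simp
    then have "\<exists>v. e \<subseteq> {v}" if "e \<in> F" for e
      using that by (auto simp: components_of_def bond_bot_def)
    moreover have "card e = 2" if "e \<in> F" for e
      using that \<open>F \<subseteq> E\<close> assms by (auto simp: simple_graph_def)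
    ultimately show "F = {}"
      by (metis One_nat_def all_not_in_conv card.empty card_1_singleton_iff nat.distinct(1)
          numeral_2_eq_2 old.nat.inject subset_singleton_iff)
  next
    assume "F = {}"
    then show "components V F = bond_bot V"
      by (auto intro!: components_eqI simp: components_of_def bond_bot_in_bond_lattice)
  qed
  then have "{F. F \<subseteq> E \<and> components V F = bond_bot V} = {{}}" by auto
  then show ?thesis by (simp add: bond_coeff_def)
qed

text \<open>Choosing representatives injects the parts into \<open>V\<close>. If the injection is
  onto, every point represents its own part, so all parts are singletons.\<close>

lemma partition_on_card_le:
  assumes "finite V" "partition_on V \<pi>"
  shows "card \<pi> \<le> card V" and "card \<pi> = card V \<Longrightarrow> \<pi> = bond_bot V"
proof -
  define rep where "rep S = (SOME v. v \<in> S)" for S :: "'a set"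
  have rep: "rep S \<in> S" if "S \<in> \<pi>" for S
  proof -
    have "S \<noteq> {}" using that partition_onD3[OF assms(2)] by blast
    then show ?thesis by (simp add: rep_def some_in_eq)
  qed
  have inj: "inj_on rep \<pi>"
    using rep partition_on_part_eq[OF assms(2)] by (metis inj_onI)
  have sub: "rep ` \<pi> \<subseteq> V"
    using rep partition_onD1[OF assms(2)] by blast
  show le: "card \<pi> \<le> card V"
    using inj sub assms(1) by (rule card_inj_on_le)
  assume "card \<pi> = card V"
  then have surj: "rep ` \<pi> = V"
    using sub assms(1) inj by (intro card_subset_eq) (simp_all add: card_image)
  have "S = {rep S}" if "S \<in> \<pi>" for S
  proof -
    have "x = rep S" if "x \<in> S" for x
    proof -
      have "x \<in> V" using that \<open>S \<in> \<pi>\<close> partition_onD1[OF assms(2)] by blast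
      then obtain T where T: "T \<in> \<pi>" "x = rep T" using surj by blast
      then have "T = S"
        using partition_on_part_eq[OF assms(2) T(1) \<open>S \<in> \<pi>\<close>] rep[OF T(1)] that by blast
      with T show ?thesis by simp
    qed
    with rep[OF that] show ?thesis by blast
  qed
  then have "\<pi> = (\<lambda>S. {rep S}) ` \<pi>" by force
  also have "\<dots> = (\<lambda>v. {v}) ` rep ` \<pi>" by (simp add: image_image)
  finally show "\<pi> = bond_bot V" using surj by (simp add: bond_bot_def)
qed

text \<open>The total weight of walks of length \<open>k\<close> from \<open>\<pi>\<close>, that is,
  the \<open>\<pi>\<close>-entry of \<open>Z\<^sup>k \<zeta>\<close>, indexed by partitions instead
  of matrix positions.\<close>

primrec bond_walk :: "'a set \<Rightarrow> 'a set set \<Rightarrow> nat \<Rightarrow> 'a set set \<Rightarrow> rat poly" where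
  "bond_walk V E 0 \<pi> = 1"
| "bond_walk V E (Suc k) \<pi> = (\<Sum>\<pi>'\<in>bond_lattice V E. bond_entry V E \<pi> \<pi>' * bond_walk V E k \<pi>')"

lemma card_bond_covers:
  assumes "simple_graph V E" "bond_covers V E \<pi> \<pi>'"
  shows "card \<pi>' = Suc (card \<pi>)"
proof -
  obtain e where "e \<in> E" "merge \<pi>' e = \<pi>" using bond_coversE[OF assms] .
  then show ?thesis
    using card_merge[OF assms(1), of e \<pi>'] assms(2) by (auto simp: bond_covers_def bond_lattice_def)
qed

text \<open>A covering step uses up one unit of length and gains one part, so
  \<open>k + card \<pi>\<close> is unchanged; only the loop at the bottom raises the exponent. The
  bound on \<open>k\<close> makes the truncated subtraction exact and leaves enough steps to reach
  the bottom.\<close>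

lemma bond_walk_eq:
  assumes G: "simple_graph V E" and L: "\<pi> \<in> bond_lattice V E" and k: "card V \<le> k + card \<pi>"
  shows "bond_walk V E k \<pi> = monom (bond_coeff V E \<pi>) (k + card \<pi> - card V)"
  using L k
proof (induction k arbitrary: \<pi>)
  case 0
  have finV: "finite V" using G by (simp add: simple_graph_def)
  have P: "partition_on V \<pi>" using 0 by (simp add: bond_lattice_def)
  have "card \<pi> = card V" using partition_on_card_le(1)[OF finV P] 0 by simp
  with partition_on_card_le(2)[OF finV P] show ?case
    using bond_coeff_bot[OF G] by (simp add: monom_0)
next
  case (Suc k)
  have finV: "finite V" using G by (simp add: simple_graph_def)
  have finL: "finite (bond_lattice V E)" using finV by (rule finite_bond_lattice)
  have card_bot: "card (bond_bot V) = card V"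
    by (simp add: bond_bot_def card_image)
  show ?case
  proof (cases "\<pi> = bond_bot V")
    case True
    \<comment> \<open>A partition below the bottom would have more than \<open>card V\<close> parts,
      so the loop is the only step available.\<close>
    have "\<not> bond_covers V E \<pi> \<pi>'" for \<pi>'
    proof
      assume cov: "bond_covers V E \<pi> \<pi>'"
      then have "partition_on V \<pi>'" by (simp add: bond_covers_def bond_lattice_def)
      then have "card \<pi>' \<le> card V" using finV partition_on_card_le(1) by blast
      with card_bond_covers[OF G cov] card_bot True show False by simp
    qed
    then have "bond_walk V E (Suc k) \<pi>
        = (\<Sum>\<pi>'\<in>bond_lattice V E. if \<pi>' = \<pi> then [:0, 1:] * bond_walk V E k \<pi>' else 0)"
      unfolding bond_walk.simps
      by (intro sum.cong refl) (auto simp: bond_entry_def True)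
    also have "\<dots> = [:0, 1:] * bond_walk V E k \<pi>"
      using finL Suc.prems by simp
    also have "bond_walk V E k \<pi> = monom (bond_coeff V E \<pi>) (k + card \<pi> - card V)"
      using Suc.prems card_bot True by (intro Suc.IH) auto
    finally show ?thesis
      using card_bot True by (simp add: monom_Suc)
  next
    case False
    define C where "C = {\<pi>'. \<pi>' \<in> bond_lattice V E \<and> bond_covers V E \<pi> \<pi>'}"
    have "bond_walk V E (Suc k) \<pi>
        = (\<Sum>\<pi>'\<in>bond_lattice V E. if bond_covers V E \<pi> \<pi>'
            then [:- bond_weight E \<pi> \<pi>':] * bond_walk V E k \<pi>' else 0)"
      unfolding bond_walk.simps
      by (intro sum.cong refl) (use False in \<open>auto simp: bond_entry_def\<close>)
    also have "\<dots> = (\<Sum>\<pi>'\<in>C. [:- bond_weight E \<pi> \<pi>':] * bond_walk V E k \<pi>')"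
      using finL by (simp only: C_def sum.inter_filter)
    also have "\<dots> = (\<Sum>\<pi>'\<in>C. monom (- (bond_weight E \<pi> \<pi>' * bond_coeff V E \<pi>')) (Suc k + card \<pi> - card V))"
    proof (intro sum.cong refl)
      fix \<pi>' assume "\<pi>' \<in> C"
      then have *: "\<pi>' \<in> bond_lattice V E" "card \<pi>' = Suc (card \<pi>)"
        using card_bond_covers[OF G] by (auto simp: C_def)
      then have "bond_walk V E k \<pi>' = monom (bond_coeff V E \<pi>') (k + card \<pi>' - card V)"
        using Suc.prems by (intro Suc.IH) auto
      then show "[:- bond_weight E \<pi> \<pi>':] * bond_walk V E k \<pi>'
          = monom (- (bond_weight E \<pi> \<pi>' * bond_coeff V E \<pi>')) (Suc k + card \<pi> - card V)"
        using * by (simp add: smult_monom)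
    qed
    also have "\<dots> = monom (bond_coeff V E \<pi>) (Suc k + card \<pi> - card V)"
      using bond_coeff_recursion[OF G Suc.prems(1) False]
      by (simp add: C_def monom_sum[symmetric] sum_negf)
    finally show ?thesis .
  qed
qed

section \<open>Matrix powers and the final sum\<close>

text \<open>Matrix powers unfold by a factor on the right, whereas \<open>bond_walk\<close> splits
  off the first step, on the left.\<close>

lemma pow_mat_Suc_left:
  assumes "A \<in> carrier_mat n n"
  shows "A ^\<^sub>m Suc k = A * A ^\<^sub>m k"
proof (induction k)
  case 0
  show ?case using assms by simp
next
  case (Suc k)
  have "A ^\<^sub>m Suc (Suc k) = (A * A ^\<^sub>m k) * A" using Suc by simp
  also have "\<dots> = A * (A ^\<^sub>m k * A)"
    using assms by (intro assoc_mult_mat[of _ n n _ n _ n]) (auto simp: pow_carrier_mat)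
  finally show ?case by simp
qed

lemma bond_matrix_pow_mult_vec:
  assumes b: "bij_betw b {..<card (bond_lattice V E)} (bond_lattice V E)"
  shows "(bond_matrix V E b ^\<^sub>m k) *\<^sub>v vec (card (bond_lattice V E)) (\<lambda>_. 1)
    = vec (card (bond_lattice V E)) (\<lambda>i. bond_walk V E k (b i))"
proof (induction k)
  case 0
  show ?case by (auto simp: bond_matrix_def)
next
  case (Suc k)
  define n where "n = card (bond_lattice V E)"
  let ?Z = "bond_matrix V E b"
  have Z: "?Z \<in> carrier_mat n n" by (simp add: bond_matrix_def n_def)
  have "(?Z ^\<^sub>m Suc k) *\<^sub>v vec n (\<lambda>_. 1) = (?Z * ?Z ^\<^sub>m k) *\<^sub>v vec n (\<lambda>_. 1)"
    by (simp only: pow_mat_Suc_left[OF Z])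
  also have "\<dots> = ?Z *\<^sub>v (?Z ^\<^sub>m k *\<^sub>v vec n (\<lambda>_. 1))"
    using Z by (intro assoc_mult_mat_vec[of _ n n _ n]) (auto simp: pow_carrier_mat)
  also have "\<dots> = ?Z *\<^sub>v vec n (\<lambda>i. bond_walk V E k (b i))"
    using Suc by (simp add: n_def)
  also have "\<dots> = vec n (\<lambda>i. bond_walk V E (Suc k) (b i))"
  proof (rule eq_vecI)
    fix i assume "i < dim_vec (vec n (\<lambda>i. bond_walk V E (Suc k) (b i)))"
    then have i: "i < n" by simp
    have "(?Z *\<^sub>v vec n (\<lambda>i. bond_walk V E k (b i))) $ i
        = (\<Sum>j\<in>{..<n}. bond_entry V E (b i) (b j) * bond_walk V E k (b j))"
      using i by (simp add: bond_matrix_def n_def scalar_prod_def atLeast0LessThan)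
    also have "\<dots> = bond_walk V E (Suc k) (b i)"
      unfolding bond_walk.simps using sum.reindex_bij_betw[OF b] by (simp add: n_def)
    finally show "(?Z *\<^sub>v vec n (\<lambda>i. bond_walk V E k (b i))) $ i
        = vec n (\<lambda>i. bond_walk V E (Suc k) (b i)) $ i"
      using i by simp
  qed (simp add: bond_matrix_def n_def)
  finally show ?case by (simp only: n_def)
qed

theorem corollary1p7:
  fixes V :: "'a set" and E :: "'a set set" and b :: "nat \<Rightarrow> 'a set set"
    and Z :: "rat poly mat" and \<zeta> :: "rat poly vec"
  assumes "simple_graph V E"
    and "bij_betw b {..<card (bond_lattice V E)} (bond_lattice V E)"
    and "Z = bond_matrix V E b"
    and "\<zeta> = vec (card (bond_lattice V E)) (\<lambda>_. 1)"
  shows "chromatic_polynomial V E = \<zeta> \<bullet> ((Z ^\<^sub>m card V) *\<^sub>v \<zeta>)"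
proof -
  have "\<zeta> \<bullet> ((Z ^\<^sub>m card V) *\<^sub>v \<zeta>) = (\<Sum>i\<in>{..<card (bond_lattice V E)}. bond_walk V E (card V) (b i))"
    unfolding assms(3,4) bond_matrix_pow_mult_vec[OF assms(2)]
    by (simp add: scalar_prod_def atLeast0LessThan)
  also have "\<dots> = (\<Sum>\<pi>\<in>bond_lattice V E. bond_walk V E (card V) \<pi>)"
    using sum.reindex_bij_betw[OF assms(2)] .
  \<comment> \<open>With walks of length \<open>card V\<close> the length bound holds for every
    \<open>\<pi>\<close>, and the exponent reduces to \<open>card \<pi>\<close>, as in Whitney's
    formula.\<close>
  also have "\<dots> = (\<Sum>\<pi>\<in>bond_lattice V E. monom (bond_coeff V E \<pi>) (card \<pi>))"
    using bond_walk_eq[OF assms(1)] by (intro sum.cong) simp_all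
  also have "\<dots> = chromatic_polynomial V E"
    using chromatic_polynomial_eq_sum[OF assms(1)] by simp
  finally show ?thesis by simp
qed

end
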